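(* Let $L$ be a normal incline and let $A$ be an $n\times n$ completely positive matrix over $L$ such that every right almost principal $2\times 2$ submatrix of $A$ has positive determinant greater than or equal to its negative determinant. Then $A$ is LU-completely positive.
   Context: An incline is a nonempty set $L$ with binary operations $\oplus,\otimes$ such that $(L,\oplus)$ is a semilattice ($\oplus$ associative, commutative, idempotent), $(L,\otimes)$ is a semigroup, $x\otimes(y\oplus z)=(x\otimes y)\oplus(x\otimes z)$ and $x\oplus(x\otimes y)=x$ for all $x,y,z$. The order is $x\le y\iff x\oplus y=y$; $L$ is commutative if $\otimes$ is commutative. An r-ideal is a nonempty $J\subseteq L$ closed under $\oplus$ and under multiplication by arbitrary elements of $L$; a lattice ideal is a nonempty $J\subseteq L$ closed under $\oplus$ and downward closed. A commutative incline $L$ is normal if it has an additive identity $\mathbf{0}$ and a multiplicative identity $\mathbf{1}$ and: every singly generated r-ideal is a lattice ideal (LI-property); for each $x$ there is a unique $c$ with $c\otimes c=x$; $x\otimes y\le(x\otimes x)\oplus(y\otimes y)$ for all $x,y$. Matrix product: $(BC)_{ij}=\bigoplus_k b_{ik}\otimes c_{kj}$; $B^T$ is the transpose. $A$ is completely positive if $A=BB^T$ for some $n\times k$ matrix $B$ over $L$ all of whose entries are of the form $c\otimes c$. $A$ is LU-completely positive if $A=CC^T$ for some lower triangular $n\times n$ matrix $C$ over $L$. For index sets $\alpha=\{\alpha_1<\dots<\alpha_k\}$, $\beta=\{\beta_1<\dots<\beta_k\}$, $A[\alpha|\beta]$ is the submatrix with $(i,j)$ entry $a_{\alpha_i\beta_j}$;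 it is right almost principal if $\alpha_j=\beta_j$ for $1\le j\le k-1$ but $\alpha_k\ne\beta_k$. For a $2\times 2$ matrix $\begin{bmatrix}p&q\\ r&s\end{bmatrix}$, the positive determinant is $p\otimes s$ and the negative determinant is $q\otimes r$. *)

theory Defs
  imports Main
begin

text \<open>An incline is represented by a type 'a (the carrier L = UNIV) together with
  two operations add (the semilattice join, written \<oplus> in the paper) and
  mul (written \<otimes> in the paper).\<close>

definition incline :: "('a \<Rightarrow> 'a \<Rightarrow> 'a) \<Rightarrow> ('a \<Rightarrow> 'a \<Rightarrow> 'a) \<Rightarrow> bool" where
  "incline add mul \<longleftrightarrow>
     (\<forall>x y z. add (add x y) z = add x (add y z)) \<and>
     (\<forall>x y. add x y = add y x) \<and>
     (\<forall>x. add x x = x) \<and>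
     (\<forall>x y z. mul (mul x y) z = mul x (mul y z)) \<and>
     (\<forall>x y z. mul x (add y z) = add (mul x y) (mul x z)) \<and>
     (\<forall>x y. add x (mul x y) = x)"

definition inc_le :: "('a \<Rightarrow> 'a \<Rightarrow> 'a) \<Rightarrow> 'a \<Rightarrow> 'a \<Rightarrow> bool" where
  "inc_le add x y \<longleftrightarrow> add x y = y"

definition r_ideal :: "('a \<Rightarrow> 'a \<Rightarrow> 'a) \<Rightarrow> ('a \<Rightarrow> 'a \<Rightarrow> 'a) \<Rightarrow> 'a set \<Rightarrow> bool" where
  "r_ideal add mul J \<longleftrightarrow> J \<noteq> {} \<and>
     (\<forall>x\<in>J. \<forall>y\<in>J. add x y \<in> J) \<and>
     (\<forall>x\<in>J. \<forall>y. mul x y \<in> J \<and> mul y x \<in> J)"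

definition lattice_ideal :: "('a \<Rightarrow> 'a \<Rightarrow> 'a) \<Rightarrow> 'a set \<Rightarrow> bool" where
  "lattice_ideal add J \<longleftrightarrow> J \<noteq> {} \<and>
     (\<forall>x\<in>J. \<forall>y\<in>J. add x y \<in> J) \<and>
     (\<forall>x\<in>J. \<forall>y. inc_le add y x \<longrightarrow> y \<in> J)"

definition r_ideal_gen :: "('a \<Rightarrow> 'a \<Rightarrow> 'a) \<Rightarrow> ('a \<Rightarrow> 'a \<Rightarrow> 'a) \<Rightarrow> 'a \<Rightarrow> 'a set" where
  "r_ideal_gen add mul a = \<Inter>{J. r_ideal add mul J \<and> a \<in> J}"

definition normal_incline ::
  "('a \<Rightarrow> 'a \<Rightarrow> 'a) \<Rightarrow> ('a \<Rightarrow> 'a \<Rightarrow> 'a) \<Rightarrow> 'a \<Rightarrow> 'a \<Rightarrow> bool" where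
  "normal_incline add mul zero one \<longleftrightarrow>
     incline add mul \<and>
     (\<forall>x y. mul x y = mul y x) \<and>
     (\<forall>x. add x zero = x) \<and>
     (\<forall>x. mul one x = x \<and> mul x one = x) \<and>
     (\<forall>a. lattice_ideal add (r_ideal_gen add mul a)) \<and>
     (\<forall>x. \<exists>!c. mul c c = x) \<and>
     (\<forall>x y. inc_le add (mul x y) (add (mul x x) (mul y y)))"

text \<open>Matrices are functions nat \<Rightarrow> nat \<Rightarrow> 'a; only the entries with indices in
  range are relevant. The finite join over an index set {0..<k} starts from zero
  (the additive identity).\<close>

definition isum :: "('a \<Rightarrow> 'a \<Rightarrow> 'a) \<Rightarrow> 'a \<Rightarrow> (nat \<Rightarrow> 'a) \<Rightarrow> nat \<Rightarrow> 'a" where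
  "isum add zero f k = foldr (\<lambda>i acc. add (f i) acc) [0..<k] zero"

definition mat_mult ::
  "('a \<Rightarrow> 'a \<Rightarrow> 'a) \<Rightarrow> ('a \<Rightarrow> 'a \<Rightarrow> 'a) \<Rightarrow> 'a \<Rightarrow> nat \<Rightarrow>
   (nat \<Rightarrow> nat \<Rightarrow> 'a) \<Rightarrow> (nat \<Rightarrow> nat \<Rightarrow> 'a) \<Rightarrow> nat \<Rightarrow> nat \<Rightarrow> 'a" where
  "mat_mult add mul zero k B C i j = isum add zero (\<lambda>l. mul (B i l) (C l j)) k"

definition mat_transpose :: "(nat \<Rightarrow> nat \<Rightarrow> 'a) \<Rightarrow> nat \<Rightarrow> nat \<Rightarrow> 'a" where
  "mat_transpose B i j = B j i"

definition completely_positive ::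
  "('a \<Rightarrow> 'a \<Rightarrow> 'a) \<Rightarrow> ('a \<Rightarrow> 'a \<Rightarrow> 'a) \<Rightarrow> 'a \<Rightarrow> nat \<Rightarrow> (nat \<Rightarrow> nat \<Rightarrow> 'a) \<Rightarrow> bool" where
  "completely_positive add mul zero n A \<longleftrightarrow>
     (\<exists>k B. (\<forall>i<n. \<forall>l<k. \<exists>c. B i l = mul c c) \<and>
            (\<forall>i<n. \<forall>j<n. A i j = mat_mult add mul zero k B (mat_transpose B) i j))"

definition LU_completely_positive ::
  "('a \<Rightarrow> 'a \<Rightarrow> 'a) \<Rightarrow> ('a \<Rightarrow> 'a \<Rightarrow> 'a) \<Rightarrow> 'a \<Rightarrow> nat \<Rightarrow> (nat \<Rightarrow> nat \<Rightarrow> 'a) \<Rightarrow> bool" where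
  "LU_completely_positive add mul zero n A \<longleftrightarrow>
     (\<exists>C. (\<forall>i<n. \<forall>j<n. i < j \<longrightarrow> C i j = zero) \<and>
          (\<forall>i<n. \<forall>j<n. A i j = mat_mult add mul zero n C (mat_transpose C) i j))"

text \<open>Every right almost principal 2 \<times> 2 submatrix A[{a1<a2}|{b1<b2}] (a1 = b1,
  a2 \<noteq> b2) has positive determinant p\<otimes>s \<ge> negative determinant q\<otimes>r.\<close>
definition rap2_condition ::
  "('a \<Rightarrow> 'a \<Rightarrow> 'a) \<Rightarrow> ('a \<Rightarrow> 'a \<Rightarrow> 'a) \<Rightarrow> nat \<Rightarrow> (nat \<Rightarrow> nat \<Rightarrow> 'a) \<Rightarrow> bool" where
  "rap2_condition add mul n A \<longleftrightarrow>
     (\<forall>a1 a2 b1 b2. a1 < a2 \<and> a2 < n \<and> b1 < b2 \<and> b2 < n \<and> a1 = b1 \<and> a2 \<noteq> b2 \<longrightarrow>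
        inc_le add (mul (A a1 b2) (A a2 b1)) (mul (A a1 b1) (A a2 b2)))"

end

(* Squaring is an injective semilattice endomorphism, so complete positivity gives
   a_ij <= s_i s_j with s_i the square root of a_ii, and the LI-property lets one write
   a_ij = s_i c_ji with c_ji <= s_j. These c_ji are candidates for the Cholesky factor; what is
   needed is c_ji c_li <= a_jl, while the hypothesis on submatrices only gives
   s_i^2 c_ji c_li <= s_i^2 a_jl. As s_i need not be cancellable, the c_ji are multiplied by some v
   with v s_i = s_i and c_ji c_li v <= a_jl. Intuitively v is 1 on the support of s_i and small
   where c_ji c_li exceeds a_jl; it is the quotient of a_jl + s_i by c_ji c_li + a_jl + s_i. *)
theory Submission
  imports Defs
begin

locale normal_incline_loc =
  fixes add :: "'a \<Rightarrow> 'a \<Rightarrow> 'a" (infixl "\<oplus>" 65)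
    and mul :: "'a \<Rightarrow> 'a \<Rightarrow> 'a" (infixl "\<otimes>" 70)
    and zero one :: 'a
  assumes normal: "normal_incline (\<oplus>) (\<otimes>) zero one"
begin

section \<open>Order and monotonicity of the product\<close>

abbreviation le :: "'a \<Rightarrow> 'a \<Rightarrow> bool" (infix "\<sqsubseteq>" 50)
  where "x \<sqsubseteq> y \<equiv> inc_le (\<oplus>) x y"

lemma add_assoc: "x \<oplus> y \<oplus> z = x \<oplus> (y \<oplus> z)"
  and add_comm: "x \<oplus> y = y \<oplus> x"
  and add_idem: "x \<oplus> x = x"
  and mul_assoc: "x \<otimes> y \<otimes> z = x \<otimes> (y \<otimes> z)"
  and distrib: "x \<otimes> (y \<oplus> z) = x \<otimes> y \<oplus> x \<otimes> z"
  and absorb: "x \<oplus> x \<otimes> y = x"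
  and mul_comm: "x \<otimes> y = y \<otimes> x"
  and add_zero: "x \<oplus> zero = x"
  and mul_one: "x \<otimes> one = x"
  and ideal: "lattice_ideal (\<oplus>) (r_ideal_gen (\<oplus>) (\<otimes>) a)"
  and ex1_sqrt: "\<exists>!c. c \<otimes> c = x"
  and mul_le_squares: "x \<otimes> y \<sqsubseteq> x \<otimes> x \<oplus> y \<otimes> y"
  using normal unfolding normal_incline_def incline_def by metis+

lemma distrib_right: "(y \<oplus> z) \<otimes> x = y \<otimes> x \<oplus> z \<otimes> x"
  by (metis distrib mul_comm)

sublocale mul: comm_monoid "(\<otimes>)" one
  by unfold_locales (fact mul_assoc mul_comm mul_one)+

sublocale ord: semilattice_sup "(\<oplus>)" "(\<sqsubseteq>)" "\<lambda>x y. x \<sqsubseteq> y \<and> x \<noteq> y"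
  by unfold_locales (auto simp: inc_le_def, (metis add_assoc add_comm add_idem)+)

lemma mul_le_left: "x \<otimes> y \<sqsubseteq> x"
  by (metis absorb add_comm inc_le_def)

lemma mul_le_right: "x \<otimes> y \<sqsubseteq> y"
  by (metis mul_le_left mul_comm)

lemma zero_le: "zero \<sqsubseteq> x"
  by (metis add_zero add_comm inc_le_def)

lemma mul_mono: "x \<sqsubseteq> x' \<Longrightarrow> y \<sqsubseteq> y' \<Longrightarrow> x \<otimes> y \<sqsubseteq> x' \<otimes> y'"
  by (rule ord.order_trans[of _ "x' \<otimes> y"])
    (simp_all add: inc_le_def distrib[symmetric] distrib_right[symmetric])

lemma mul_zero: "x \<otimes> zero = zero"
  using mul_le_right zero_le ord.order.antisym by blast

text \<open>This turns the LI-property into division. The multiples of \<open>a\<close> form an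
  r-ideal containing \<open>a\<close>, so the r-ideal generated by \<open>a\<close> consists of
  multiples, and by the LI-property it is downward closed.\<close>

lemma le_imp_multiple:
  assumes "y \<sqsubseteq> a"
  obtains z where "y = a \<otimes> z"
proof -
  let ?J = "{a \<otimes> z |z. True}"
  have J: "r_ideal (\<oplus>) (\<otimes>) ?J"
    unfolding r_ideal_def by (auto simp: distrib[symmetric] mul_assoc) (metis mul.left_commute)
  have aJ: "a \<in> ?J"
    by (auto intro!: exI[of _ one] simp: mul_one)
  have "a \<in> r_ideal_gen (\<oplus>) (\<otimes>) a"
    by (simp add: r_ideal_gen_def)
  then have "y \<in> r_ideal_gen (\<oplus>) (\<otimes>) a"
    using assms ideal[of a] unfolding lattice_ideal_def by blast
  also have "\<dots> \<subseteq> ?J"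
    unfolding r_ideal_gen_def using J aJ by blast
  finally show thesis using that by blast
qed

section \<open>Square roots, cancellation and separating elements\<close>

lemma square_add: "(x \<oplus> y) \<otimes> (x \<oplus> y) = x \<otimes> x \<oplus> y \<otimes> y"
proof (rule ord.order.antisym)
  show "(x \<oplus> y) \<otimes> (x \<oplus> y) \<sqsubseteq> x \<otimes> x \<oplus> y \<otimes> y"
    using mul_le_squares[of x y] by (auto simp: distrib distrib_right mul_comm[of y x])
  show "x \<otimes> x \<oplus> y \<otimes> y \<sqsubseteq> (x \<oplus> y) \<otimes> (x \<oplus> y)"
    by (auto intro: mul_mono)
qed

text \<open>If the square of \<open>x\<close> lies below that of \<open>y\<close>, then
  \<open>x \<oplus> y\<close> and \<open>y\<close> have the same square, and square roots are
  unique.\<close>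

lemma le_of_square_le: "x \<otimes> x \<sqsubseteq> y \<otimes> y \<Longrightarrow> x \<sqsubseteq> y"
  by (metis square_add ex1_sqrt inc_le_def)

text \<open>Both sides of the conclusion have the same square, because one copy of \<open>x\<close>
  at a time can be exchanged for \<open>y\<close> next to \<open>s \<otimes> s\<close>. So one of
  two equal factors can be removed even when \<open>s\<close> is not cancellable.\<close>

lemma cancel_eq:
  assumes "s \<otimes> s \<otimes> x = s \<otimes> s \<otimes> y"
  shows "s \<otimes> x = s \<otimes> y"
proof -
  have "(s \<otimes> x) \<otimes> (s \<otimes> x) = s \<otimes> s \<otimes> x \<otimes> x"
    by (simp add: mul.left_commute mul.commute mul.assoc)
  also have "\<dots> = s \<otimes> s \<otimes> x \<otimes> y"
    unfolding assms by (metis assms mul_assoc mul_comm)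
  also have "\<dots> = (s \<otimes> y) \<otimes> (s \<otimes> y)"
    unfolding assms by (simp add: mul.left_commute mul.commute mul.assoc)
  finally show ?thesis
    using ex1_sqrt by blast
qed

lemma cancel_le: "s \<otimes> s \<otimes> x \<sqsubseteq> s \<otimes> s \<otimes> y \<Longrightarrow> s \<otimes> x \<sqsubseteq> s \<otimes> y"
  unfolding inc_le_def distrib[symmetric] by (rule cancel_eq)

text \<open>If \<open>\<otimes>\<close> is the meet of a distributive lattice, this follows from p =
  (p meet y) join (p meet s). In general, dividing \<open>p\<close>, \<open>y\<close> and
  \<open>s\<close> by their common bound \<open>w\<close> and cancelling one \<open>w\<close> bounds
  the part of \<open>p\<close> that comes from \<open>s\<close>.\<close>

lemma le_of_le_add_of_mul_le:
  assumes "p \<sqsubseteq> y \<oplus> s" "p \<otimes> s \<sqsubseteq> y \<otimes> s"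
  shows "p \<sqsubseteq> y"
proof -
  define w where "w = y \<oplus> s"
  obtain p' where p': "p = w \<otimes> p'"
    using assms(1) le_imp_multiple unfolding w_def by blast
  obtain a where a: "y = w \<otimes> a"
    using le_imp_multiple ord.sup_ge1 unfolding w_def by blast
  obtain b where b: "s = w \<otimes> b"
    using le_imp_multiple ord.sup_ge2 unfolding w_def by blast
  have "w \<otimes> w \<otimes> (p' \<otimes> b) \<sqsubseteq> w \<otimes> w \<otimes> (a \<otimes> b)"
    using assms(2) unfolding p' a b by (simp add: mul.left_commute mul.commute mul.assoc)
  then have "w \<otimes> (p' \<otimes> b) \<sqsubseteq> w \<otimes> (a \<otimes> b)"
    by (rule cancel_le)
  moreover have "w \<otimes> (p' \<otimes> b) = s \<otimes> p'"
    unfolding b by (simp add: mul.left_commute mul.commute mul.assoc)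
  moreover have "w \<otimes> (a \<otimes> b) = y \<otimes> b"
    unfolding a by (simp add: mul_assoc)
  ultimately have "s \<otimes> p' \<sqsubseteq> y"
    using mul_le_left ord.order_trans by metis
  moreover have "p = y \<otimes> p' \<oplus> s \<otimes> p'"
    unfolding p' w_def by (rule distrib_right)
  ultimately show ?thesis
    by (simp add: mul_le_left)
qed

lemma exists_separating:
  assumes "s \<otimes> t \<sqsubseteq> s \<otimes> y"
  obtains v where "s \<otimes> v = s" "t \<otimes> v \<sqsubseteq> y"
proof -
  define w where "w = t \<oplus> (y \<oplus> s)"
  obtain v where v: "y \<oplus> s = w \<otimes> v"
    using le_imp_multiple ord.sup_ge2 unfolding w_def by blast
  obtain z where z: "s = w \<otimes> z"
    using le_imp_multiple[of s w] unfolding w_def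
    by (metis ord.le_supI2 ord.sup_ge2)
  \<comment> \<open>Multiplied by \<open>s\<close>, the summand \<open>t\<close> of \<open>w\<close>
    is absorbed by \<open>y\<close>.\<close>
  have "s \<otimes> w = s \<otimes> (y \<oplus> s)"
    using assms unfolding w_def distrib inc_le_def by (metis add_assoc)
  then have "s \<otimes> w = s \<otimes> (w \<otimes> v)"
    unfolding v .
  \<comment> \<open>The factor \<open>z\<close> turns \<open>w\<close> into \<open>s\<close>, which
    leaves an equation with a factor \<open>s \<otimes> s\<close> to cancel.\<close>
  then have "s \<otimes> w \<otimes> z = s \<otimes> (w \<otimes> v) \<otimes> z"
    by simp
  moreover have "s \<otimes> w \<otimes> z = s \<otimes> s"
    using z by (simp add: mul_assoc)
  moreover have "s \<otimes> (w \<otimes> v) \<otimes> z = s \<otimes> s \<otimes> v"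
    using z by (metis mul_assoc mul_comm)
  ultimately have "s \<otimes> s \<otimes> v = s \<otimes> s \<otimes> one"
    by (simp add: mul_one)
  then have sv: "s \<otimes> v = s"
    using cancel_eq mul_one by metis
  have "t \<otimes> v \<sqsubseteq> y \<oplus> s"
    unfolding v by (rule mul_mono) (auto simp: w_def)
  moreover have "t \<otimes> v \<otimes> s \<sqsubseteq> y \<otimes> s"
    using assms sv by (metis mul_assoc mul_comm)
  ultimately have "t \<otimes> v \<sqsubseteq> y"
    by (rule le_of_le_add_of_mul_le)
  with sv show thesis by (rule that)
qed

text \<open>The product of the separating elements works for all pairs at once: each factor fixes
  \<open>s\<close>, and further factors only decrease \<open>t q \<otimes> v\<close>.\<close>

lemma exists_separating_finite:
  assumes "finite P" "\<And>q. q \<in> P \<Longrightarrow> s \<otimes> t q \<sqsubseteq> s \<otimes> y q"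
  shows "\<exists>v. s \<otimes> v = s \<and> (\<forall>q\<in>P. t q \<otimes> v \<sqsubseteq> y q)"
  using assms
proof (induction P)
  case empty
  show ?case by (auto intro: mul_one)
next
  case (insert q P)
  obtain v where v: "s \<otimes> v = s" "\<forall>q\<in>P. t q \<otimes> v \<sqsubseteq> y q"
    using insert by auto
  obtain u where u: "s \<otimes> u = s" "t q \<otimes> u \<sqsubseteq> y q"
    using exists_separating insert.prems by blast
  have "s \<otimes> (u \<otimes> v) = s"
    using u v by (simp add: mul_assoc[symmetric])
  moreover have "t q \<otimes> (u \<otimes> v) \<sqsubseteq> y q"
    using u(2) mul_le_left ord.order_trans mul_assoc by metis
  moreover have "t r \<otimes> (u \<otimes> v) \<sqsubseteq> y r" if "r \<in> P" for r
    using v(2) that mul_le_left ord.order_trans mul_assoc mul_comm by metis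
  ultimately show ?case by blast
qed

section \<open>Finite joins and matrix products\<close>

lemma isum_le_iff: "isum (\<oplus>) zero f k \<sqsubseteq> y \<longleftrightarrow> (\<forall>i<k. f i \<sqsubseteq> y)"
proof -
  have "foldr (\<lambda>i acc. f i \<oplus> acc) xs zero \<sqsubseteq> y \<longleftrightarrow> (\<forall>i\<in>set xs. f i \<sqsubseteq> y)" for xs
    by (induction xs) (auto simp: zero_le)
  then show ?thesis
    by (auto simp: isum_def)
qed

lemma le_isum: "i < k \<Longrightarrow> f i \<sqsubseteq> isum (\<oplus>) zero f k"
  using isum_le_iff ord.order_refl by blast

text \<open>The square of \<open>B i l\<close> is a term of \<open>A i i\<close>, so
  \<open>B i l\<close> lies below the root \<open>s i\<close>; hence every term of
  \<open>A i j\<close> lies below \<open>s i \<otimes> s j\<close>.\<close>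

lemma Cauchy_Schwarz:
  assumes A: "\<And>i j. i < n \<Longrightarrow> j < n \<Longrightarrow>
      A i j = mat_mult (\<oplus>) (\<otimes>) zero k B (mat_transpose B) i j"
    and s: "\<And>i. s i \<otimes> s i = A i i"
    and "i < n" "j < n"
  shows "A i j \<sqsubseteq> s i \<otimes> s j"
proof -
  have "B i l \<sqsubseteq> s i" if "i < n" "l < k" for i l
    using that le_isum[of l k "\<lambda>l. B i l \<otimes> B i l"]
    by (intro le_of_square_le[of "B i l" "s i"]) (simp add: s A mat_mult_def mat_transpose_def)
  then show ?thesis
    using assms(3,4) by (auto simp: A mat_mult_def mat_transpose_def isum_le_iff intro: mul_mono)
qed

lemma symmetric_mat_mult_transpose:
  "mat_mult (\<oplus>) (\<otimes>) zero k B (mat_transpose B) i j =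
   mat_mult (\<oplus>) (\<otimes>) zero k B (mat_transpose B) j i"
  unfolding mat_mult_def mat_transpose_def by (subst mul_comm) (rule refl)

section \<open>Construction of the triangular factor\<close>

theorem LU_completely_positive:
  assumes cp: "completely_positive (\<oplus>) (\<otimes>) zero n A"
    and rap: "rap2_condition (\<oplus>) (\<otimes>) n A"
  shows "LU_completely_positive (\<oplus>) (\<otimes>) zero n A"
proof -
  obtain k B where A: "\<And>i j. i < n \<Longrightarrow> j < n \<Longrightarrow>
      A i j = mat_mult (\<oplus>) (\<otimes>) zero k B (mat_transpose B) i j"
    using cp unfolding completely_positive_def by blast
  have sym: "A i j = A j i" if "i < n" "j < n" for i j
    using that A symmetric_mat_mult_transpose by metis
  have "\<exists>c. c \<otimes> c = A i i" for i
    using ex1_sqrt by blast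
  then obtain s where s: "\<And>i. s i \<otimes> s i = A i i"
    by metis
  have "\<exists>c. s i \<otimes> c = A j i \<and> c \<sqsubseteq> s j" if "i < n" "j < n" for j i
  proof -
    have "A j i \<sqsubseteq> s i \<otimes> s j"
      using Cauchy_Schwarz[OF A s] that sym by metis
    then obtain z where "A j i = s i \<otimes> s j \<otimes> z"
      by (rule le_imp_multiple)
    then show ?thesis
      by (auto simp: mul_assoc intro!: exI[of _ "s j \<otimes> z"] mul_le_left)
  qed
  then have "\<forall>j i. \<exists>c. i < n \<and> j < n \<longrightarrow> s i \<otimes> c = A j i \<and> c \<sqsubseteq> s j"
    by blast
  then obtain c where "\<forall>j i. i < n \<and> j < n \<longrightarrow> s i \<otimes> c j i = A j i \<and> c j i \<sqsubseteq> s j"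
    unfolding choice_iff by blast
  then have c: "\<And>i j. i < n \<Longrightarrow> j < n \<Longrightarrow> s i \<otimes> c j i = A j i"
    and c_le: "\<And>i j. i < n \<Longrightarrow> j < n \<Longrightarrow> c j i \<sqsubseteq> s j"
    by blast+
  \<comment> \<open>A single \<open>v\<close> has to serve the whole column \<open>i\<close>, hence
    all pairs of rows below \<open>i\<close>. Equal rows are left out because the hypothesis on
    submatrices does not cover them; there the bound \<open>c_le\<close> is used.\<close>
  have "\<exists>v. s i \<otimes> v = s i \<and>
      (\<forall>q\<in>{(j, l). j < n \<and> l < n \<and> i < j \<and> i < l \<and> j \<noteq> l}.
        (case q of (j, l) \<Rightarrow> c j i \<otimes> c l i) \<otimes> v \<sqsubseteq> (case q of (j, l) \<Rightarrow> A j l))" if "i < n" for i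
  proof (rule exists_separating_finite)
    show "finite {(j, l). j < n \<and> l < n \<and> i < j \<and> i < l \<and> j \<noteq> l}"
      by (rule finite_subset[of _ "{..<n} \<times> {..<n}"]) auto
  next
    fix q assume "q \<in> {(j, l). j < n \<and> l < n \<and> i < j \<and> i < l \<and> j \<noteq> l}"
    then obtain j l where q: "q = (j, l)" and jl: "j < n" "l < n" "i < j" "i < l" "j \<noteq> l"
      by auto
    \<comment> \<open>This is the submatrix with rows i, j and columns i, l.\<close>
    have "A i l \<otimes> A j i \<sqsubseteq> A i i \<otimes> A j l"
      using rap jl unfolding rap2_condition_def by blast
    moreover have "A i l \<otimes> A j i = s i \<otimes> s i \<otimes> (c j i \<otimes> c l i)"
      using c[of i j] c[of i l] sym[of i l] jl \<open>i < n\<close>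
      by (metis mul_assoc mul_comm)
    ultimately have "s i \<otimes> s i \<otimes> (c j i \<otimes> c l i) \<sqsubseteq> s i \<otimes> s i \<otimes> A j l"
      by (simp add: s)
    then have "s i \<otimes> (c j i \<otimes> c l i) \<sqsubseteq> s i \<otimes> A j l"
      by (rule cancel_le)
    then show "s i \<otimes> (case q of (j, l) \<Rightarrow> c j i \<otimes> c l i) \<sqsubseteq> s i \<otimes> (case q of (j, l) \<Rightarrow> A j l)"
      by (simp add: q)
  qed
  then have "\<exists>v. s i \<otimes> v = s i \<and>
      (\<forall>j l. j < n \<and> l < n \<and> i < j \<and> i < l \<and> j \<noteq> l \<longrightarrow> c j i \<otimes> c l i \<otimes> v \<sqsubseteq> A j l)"
    if "i < n" for i
    using that by simp
  then have "\<forall>i. \<exists>v. i < n \<longrightarrow> s i \<otimes> v = s i \<and>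
      (\<forall>j l. j < n \<and> l < n \<and> i < j \<and> i < l \<and> j \<noteq> l \<longrightarrow> c j i \<otimes> c l i \<otimes> v \<sqsubseteq> A j l)"
    by blast
  then obtain v where "\<forall>i. i < n \<longrightarrow> s i \<otimes> v i = s i \<and>
      (\<forall>j l. j < n \<and> l < n \<and> i < j \<and> i < l \<and> j \<noteq> l \<longrightarrow> c j i \<otimes> c l i \<otimes> v i \<sqsubseteq> A j l)"
    unfolding choice_iff by blast
  then have sv: "\<And>i. i < n \<Longrightarrow> s i \<otimes> v i = s i"
    and v: "\<And>i j l. j < n \<Longrightarrow> l < n \<Longrightarrow> i < j \<Longrightarrow> i < l \<Longrightarrow> j \<noteq> l \<Longrightarrow>
        c j i \<otimes> c l i \<otimes> v i \<sqsubseteq> A j l"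
    by (blast dest: less_trans)+
  \<comment> \<open>Scaling column \<open>i\<close> by \<open>v i\<close> does not disturb its
    products with the diagonal entry, since \<open>s i\<close> absorbs \<open>v i\<close>.\<close>
  define C where "C j i = (if j < i then zero else if j = i then s i else c j i \<otimes> v i)" for j i
  have C_diag: "C j j = s j" for j
    by (simp add: C_def)
  have C_le: "C j i \<sqsubseteq> s j" if "i < n" "j < n" for i j
    using ord.order_trans[OF mul_le_left c_le[OF that]] by (simp add: C_def zero_le)
  have C_eq: "s i \<otimes> C j i = A j i" if "i \<le> j" "j < n" for i j
  proof (cases "i = j")
    case True
    then show ?thesis by (simp add: C_diag s)
  next
    case False
    then have "s i \<otimes> C j i = s i \<otimes> v i \<otimes> c j i"
      using that by (simp add: C_def mul.left_commute mul.commute mul.assoc)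
    then show ?thesis
      using sv[of i] c[of i j] that by simp
  qed
  have C_mul_le: "C j i \<otimes> C l i \<sqsubseteq> A j l" if "i < n" "j < n" "l < n" for i j l
  proof -
    \<comment> \<open>The term vanishes if a row is above the diagonal, lies below
      \<open>s j \<otimes> s j\<close> if the rows agree, and equals the entry of \<open>A\<close>
      if one row is \<open>i\<close>. Only the last case needs the separating property of
      \<open>v i\<close>.\<close>
    consider "j < i \<or> l < i" | "j = l" | "i = j" "i \<le> l" | "i = l" "i \<le> j"
      | "i < j" "i < l" "j \<noteq> l"
      by linarith
    then show ?thesis
    proof cases
      case 1
      then have "C j i \<otimes> C l i = zero"
        using mul_zero mul_comm by (metis C_def)
      then show ?thesis by (simp add: zero_le)
    next
      case 2
      then show ?thesis
        using C_le[of i j] that s by (metis mul_mono)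
    next
      case 3
      then show ?thesis
        using C_eq[of i l] sym[of j l] that C_diag ord.order_refl by metis
    next
      case 4
      then show ?thesis
        using C_eq[of i j] that C_diag mul_comm ord.order_refl by metis
    next
      case 5
      \<comment> \<open>Each factor contributes one \<open>v i\<close>; one copy gives the bound and
        the other only decreases the product.\<close>
      then have "C j i \<otimes> C l i = c j i \<otimes> c l i \<otimes> v i \<otimes> v i"
        by (simp add: C_def mul.left_commute mul.commute mul.assoc)
      then show ?thesis
        using v[of j l i] 5 that mul_le_left ord.order_trans by metis
    qed
  qed
  \<comment> \<open>The entry is attained by the single term at index \<open>j\<close>, where the
    row \<open>j\<close> contributes its diagonal element.\<close>
  have le_CC: "A j l \<sqsubseteq> mat_mult (\<oplus>) (\<otimes>) zero n C (mat_transpose C) j l"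
    if "j < n" "l < n" "j \<le> l" for j l
    using le_isum[of j n "\<lambda>i. C j i \<otimes> C l i"] C_eq[of j l] C_diag[of j] sym[of j l] that
    by (simp add: mat_mult_def mat_transpose_def)
  have "A j l = mat_mult (\<oplus>) (\<otimes>) zero n C (mat_transpose C) j l" if "j < n" "l < n" for j l
  proof (rule ord.order.antisym)
    show "A j l \<sqsubseteq> mat_mult (\<oplus>) (\<otimes>) zero n C (mat_transpose C) j l"
      using le_CC that sym symmetric_mat_mult_transpose nat_le_linear by metis
    show "mat_mult (\<oplus>) (\<otimes>) zero n C (mat_transpose C) j l \<sqsubseteq> A j l"
      using C_mul_le that by (simp add: mat_mult_def mat_transpose_def isum_le_iff)
  qed
  moreover have "\<forall>i<n. \<forall>j<n. i < j \<longrightarrow> C i j = zero"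
    by (simp add: C_def)
  ultimately show ?thesis
    unfolding LU_completely_positive_def by blast
qed

end

theorem mainTheorem8:
  fixes add mul :: "'a \<Rightarrow> 'a \<Rightarrow> 'a" and zero one :: 'a
    and n :: nat and A :: "nat \<Rightarrow> nat \<Rightarrow> 'a"
  assumes "normal_incline add mul zero one"
    and "completely_positive add mul zero n A"
    and "rap2_condition add mul n A"
  shows "LU_completely_positive add mul zero n A"
  by (rule normal_incline_loc.LU_completely_positive[OF normal_incline_loc.intro, OF assms])

end
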